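(* Let $n$ be a positive integer with $\omega(n)\ge 2$. Then $\tilde{\Gamma}_{\mathcal{H}}(\mathbb{Z}_n)$ is connected with $diam(\tilde{\Gamma}_{\mathcal{H}}(\mathbb{Z}_n))\le 3$. In particular, $$diam(\tilde{\Gamma}_{\mathcal{H}}(\mathbb{Z}_n))=\begin{cases}1, & \text{if } \omega(n)=2 \text{ and } n=p_1p_2,\\ 2, & \text{if } \omega(n)=2 \text{ and } n\neq p_1p_2,\\ 3, & \text{if } \omega(n)\ge 3,\end{cases}$$ where, when $\omega(n)=2$, $p_1,p_2$ denote the two distinct prime divisors of $n$.
   Context: $\omega(n)$ denotes the number of distinct prime divisors of $n$. A hypergraph is a pair $(V,E)$ with $E$ a set of subsets of $V$ (hyperedges). For a group $G$ with identity $e$, let $S$ be the set of all non-trivial proper subgroups of $G$. The intersection hypergraph $\tilde{\Gamma}_{\mathcal{H}}(G)$ has vertex set $V=\{H\in S : H\cap K=\{e\}\text{ for some }K\in S\}$, and $E\subseteq V$ is a hyperedge if and only if (1) for distinct $H,K\in E$, $H\cap K=\{e\}$; and (2) there is no $E'\subseteq V$ with $E'\supsetneq E$ satisfying (1). A path in a hypergraph is an alternating sequence $v_1e_1v_2e_2\ldots v_k$ of distinct vertices and distinct hyperedges with $v_i,v_{i+1}\in e_i$ for $1\le i\le k-1$; its length is its number of hyperedges. A hypergraph is connected if there is a path between any two vertices. The distance between two vertices is the minimum length of a path connecting them, and the diameter $diam$ is the maximum distance among all pairs of vertices. *)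

theory Defs
  imports "HOL-Algebra.Elementary_Groups" "HOL-Computational_Algebra.Primes"
    "HOL-Library.Extended_Nat"
begin

definition omega :: "nat \<Rightarrow> nat" where
  "omega n = card (prime_factors n)"

type_synonym 'v hypergraph = "'v set \<times> 'v set set"

abbreviation vertices :: "'v hypergraph \<Rightarrow> 'v set" where
  "vertices \<equiv> fst"

abbreviation hyperedges :: "'v hypergraph \<Rightarrow> 'v set set" where
  "hyperedges \<equiv> snd"

definition wf_hypergraph :: "'v hypergraph \<Rightarrow> bool" where
  "wf_hypergraph \<Gamma> \<longleftrightarrow> hyperedges \<Gamma> \<subseteq> Pow (vertices \<Gamma>)"

text \<open>The path \<open>v\<^sub>1 e\<^sub>1 v\<^sub>2 \<dots> v\<^sub>k\<close> is given by the list of its vertices and the list of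
  its hyperedges, both indexed from 0; its length is the length of the second list.
  The trivial path (\<open>k = 1\<close>, no hyperedges) is included.\<close>

definition hyper_path :: "'v hypergraph \<Rightarrow> 'v list \<Rightarrow> 'v set list \<Rightarrow> bool" where
  "hyper_path \<Gamma> vs es \<longleftrightarrow>
     length vs = Suc (length es) \<and>
     set vs \<subseteq> vertices \<Gamma> \<and> set es \<subseteq> hyperedges \<Gamma> \<and>
     distinct vs \<and> distinct es \<and>
     (\<forall>i<length es. vs ! i \<in> es ! i \<and> vs ! Suc i \<in> es ! i)"

definition hyper_path_between ::
    "'v hypergraph \<Rightarrow> 'v \<Rightarrow> 'v list \<Rightarrow> 'v set list \<Rightarrow> 'v \<Rightarrow> bool" where
  "hyper_path_between \<Gamma> u vs es v \<longleftrightarrow> hyper_path \<Gamma> vs es \<and> hd vs = u \<and> last vs = v"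

definition hyper_connected :: "'v hypergraph \<Rightarrow> bool" where
  "hyper_connected \<Gamma> \<longleftrightarrow>
     (\<forall>u\<in>vertices \<Gamma>. \<forall>v\<in>vertices \<Gamma>. \<exists>vs es. hyper_path_between \<Gamma> u vs es v)"

text \<open>Distances live in \<^typ>\<open>enat\<close>, so that the distance is \<open>\<infinity>\<close> when there is no path, and
  the diameter is \<open>\<infinity>\<close> when the distances are unbounded. In \<^typ>\<open>enat\<close> the infimum of a
  nonempty set is its minimum, and a finite supremum of a nonempty set is its maximum.\<close>

definition hyper_dist :: "'v hypergraph \<Rightarrow> 'v \<Rightarrow> 'v \<Rightarrow> enat" where
  "hyper_dist \<Gamma> u v = Inf {enat (length es) |vs es. hyper_path_between \<Gamma> u vs es v}"

definition hyper_diam :: "'v hypergraph \<Rightarrow> enat" where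
  "hyper_diam \<Gamma> = Sup {hyper_dist \<Gamma> u v |u v. u \<in> vertices \<Gamma> \<and> v \<in> vertices \<Gamma>}"

definition nontrivial_proper_subgroups :: "('a, 'b) monoid_scheme \<Rightarrow> 'a set set" where
  "nontrivial_proper_subgroups G =
     {H. subgroup H G \<and> H \<noteq> {\<one>\<^bsub>G\<^esub>} \<and> H \<noteq> carrier G}"

definition intersection_vertices :: "('a, 'b) monoid_scheme \<Rightarrow> 'a set set" where
  "intersection_vertices G =
     {H \<in> nontrivial_proper_subgroups G.
        \<exists>K \<in> nontrivial_proper_subgroups G. H \<inter> K = {\<one>\<^bsub>G\<^esub>}}"

definition pairwise_trivial_intersection ::
    "('a, 'b) monoid_scheme \<Rightarrow> 'a set set \<Rightarrow> bool" where
  "pairwise_trivial_intersection G E \<longleftrightarrow>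
     (\<forall>H\<in>E. \<forall>K\<in>E. H \<noteq> K \<longrightarrow> H \<inter> K = {\<one>\<^bsub>G\<^esub>})"

definition intersection_hypergraph :: "('a, 'b) monoid_scheme \<Rightarrow> 'a set hypergraph" where
  "intersection_hypergraph G =
     (intersection_vertices G,
      {E. E \<subseteq> intersection_vertices G \<and> pairwise_trivial_intersection G E \<and>
          \<not> (\<exists>E'. E' \<subseteq> intersection_vertices G \<and> E \<subset> E' \<and>
                  pairwise_trivial_intersection G E')})"

lemma wf_intersection_hypergraph: "wf_hypergraph (intersection_hypergraph G)"
  by (auto simp: wf_hypergraph_def intersection_hypergraph_def)

end

theory Submission
  imports Defs "HOL-Algebra.Multiplicative_Group"
begin

text \<open>Two distinct vertices of an intersection hypergraph on finitely many subgroups lie in a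
  common hyperedge iff they meet trivially, so distances are those of the graph of trivial
  intersection: on a path that cannot be shortened the hyperedges are automatically distinct.
  The subgroups of \<open>\<int>\<^sub>n\<close> correspond to the divisors of \<open>n\<close>, trivial intersection to coprimality,
  and the vertices to the divisors \<open>d \<noteq> 1\<close> missing some prime of \<open>n\<close>. If \<open>a\<close> misses \<open>p\<close> and \<open>b\<close>
  misses \<open>q\<close>, then \<open>a\<close>, \<open>p\<close>, \<open>q\<close>, \<open>b\<close> is a path unless there is a shorter one. A common
  neighbour of \<open>a\<close> and \<open>b\<close> exists iff some prime of \<open>n\<close> divides neither; with three primes
  \<open>p\<close>, \<open>q\<close>, \<open>r\<close> the divisors missing exactly \<open>p\<close> and exactly \<open>q\<close> share \<open>r\<close> and have none.\<close>

section \<open>Distances in hypergraphs\<close>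

lemma hyper_dist_le:
  assumes "hyper_path_between \<Gamma> u vs es v"
  shows "hyper_dist \<Gamma> u v \<le> enat (length es)"
  unfolding hyper_dist_def by (rule Inf_lower) (use assms in blast)

lemma hyper_dist_ge:
  assumes "\<And>vs es. hyper_path_between \<Gamma> u vs es v \<Longrightarrow> k \<le> length es"
  shows "enat k \<le> hyper_dist \<Gamma> u v"
  unfolding hyper_dist_def by (rule Inf_greatest) (use assms in auto)

text \<open>Without a path the infimum is taken over the empty set, which is \<infinity> in
  \<open>enat\<close>; finite distances therefore produce paths.\<close>

lemma hyper_connectedI:
  assumes "\<And>u v. u \<in> vertices \<Gamma> \<Longrightarrow> v \<in> vertices \<Gamma> \<Longrightarrow> hyper_dist \<Gamma> u v \<noteq> \<infinity>"
  shows "hyper_connected \<Gamma>"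
  unfolding hyper_connected_def
proof (intro ballI, rule ccontr)
  fix u v assume "u \<in> vertices \<Gamma>" "v \<in> vertices \<Gamma>"
    "\<nexists>vs es. hyper_path_between \<Gamma> u vs es v"
  then have "hyper_dist \<Gamma> u v = Inf {}"
    unfolding hyper_dist_def by (intro arg_cong[where f = Inf]) auto
  then have "hyper_dist \<Gamma> u v = \<infinity>"
    by (simp add: Inf_enat_def)
  with assms \<open>u \<in> vertices \<Gamma>\<close> \<open>v \<in> vertices \<Gamma>\<close> show False
    by blast
qed

lemma hyper_diam_leI:
  assumes "\<And>u v. u \<in> vertices \<Gamma> \<Longrightarrow> v \<in> vertices \<Gamma> \<Longrightarrow> hyper_dist \<Gamma> u v \<le> d"
  shows "hyper_diam \<Gamma> \<le> d"
proof -
  have "x \<le> d" if "x \<in> {hyper_dist \<Gamma> u v |u v. u \<in> vertices \<Gamma> \<and> v \<in> vertices \<Gamma>}" for x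
    using that assms by auto
  then show ?thesis
    unfolding hyper_diam_def by (rule Sup_least)
qed

lemma hyper_diam_eqI:
  assumes "\<And>u v. u \<in> vertices \<Gamma> \<Longrightarrow> v \<in> vertices \<Gamma> \<Longrightarrow> hyper_dist \<Gamma> u v \<le> d"
    and "u \<in> vertices \<Gamma>" "v \<in> vertices \<Gamma>" "d \<le> hyper_dist \<Gamma> u v"
  shows "hyper_diam \<Gamma> = d"
proof (rule antisym)
  show "hyper_diam \<Gamma> \<le> d"
    using assms(1) by (rule hyper_diam_leI)
  have "hyper_dist \<Gamma> u v \<in> {hyper_dist \<Gamma> u v |u v. u \<in> vertices \<Gamma> \<and> v \<in> vertices \<Gamma>}"
    using assms(2,3) by blast
  then have "hyper_dist \<Gamma> u v \<le> hyper_diam \<Gamma>"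
    unfolding hyper_diam_def by (rule Sup_upper)
  with assms(4) show "d \<le> hyper_diam \<Gamma>"
    by (rule order_trans)
qed

section \<open>Intersection hypergraphs of finite groups\<close>

lemma vertices_intersection_hypergraph [simp]:
  "vertices (intersection_hypergraph G) = intersection_vertices G"
  by (simp add: intersection_hypergraph_def)

lemma finite_intersection_vertices:
  assumes "finite (carrier G)"
  shows "finite (intersection_vertices G)"
proof (rule finite_subset)
  show "intersection_vertices G \<subseteq> Pow (carrier G)"
    by (auto simp: intersection_vertices_def nontrivial_proper_subgroups_def subgroup_def)
qed (use assms in simp)

lemma intersection_vertex_nontrivial:
  "H \<in> intersection_vertices G \<Longrightarrow> H \<noteq> {\<one>\<^bsub>G\<^esub>}"
  by (simp add: intersection_vertices_def nontrivial_proper_subgroups_def)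

lemma hyperedge_inter_trivial:
  assumes "E \<in> hyperedges (intersection_hypergraph G)" "H \<in> E" "K \<in> E" "H \<noteq> K"
  shows "H \<inter> K = {\<one>\<^bsub>G\<^esub>}"
  using assms by (auto simp: intersection_hypergraph_def pairwise_trivial_intersection_def)

text \<open>Hyperedges are the maximal families of pairwise trivially meeting vertices. As there are
  only finitely many families, \<open>{H, K}\<close> extends to a maximal one.\<close>

lemma ex_hyperedge:
  assumes fin: "finite (carrier G)"
    and HK: "H \<in> intersection_vertices G" "K \<in> intersection_vertices G" "H \<inter> K = {\<one>\<^bsub>G\<^esub>}"
  shows "\<exists>E \<in> hyperedges (intersection_hypergraph G). H \<in> E \<and> K \<in> E"
proof -
  define C where
    "C = {E. E \<subseteq> intersection_vertices G \<and> pairwise_trivial_intersection G E}"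
  have "finite C"
    unfolding C_def using finite_intersection_vertices[OF fin] by simp
  moreover have "{H, K} \<in> C"
    using HK by (auto simp: C_def pairwise_trivial_intersection_def)
  ultimately obtain E where E: "E \<in> C" "{H, K} \<subseteq> E" "\<forall>E'\<in>C. E \<subseteq> E' \<longrightarrow> E' = E"
    using finite_has_maximal2[of C "{H, K}"] by metis
  have "E \<in> hyperedges (intersection_hypergraph G)"
    using E(1,3) by (auto simp: intersection_hypergraph_def C_def)
  then show ?thesis
    using E(2) by auto
qed

section \<open>Upper bounds for distances from chains of trivially meeting subgroups\<close>

lemma intersection_dist_refl:
  assumes "H \<in> intersection_vertices G"
  shows "hyper_dist (intersection_hypergraph G) H H = 0"
  using hyper_dist_le[of "intersection_hypergraph G" H "[H]" "[]" H] assms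
  by (simp add: hyper_path_between_def hyper_path_def zero_enat_def[symmetric])

lemma intersection_dist_le_1:
  assumes "finite (carrier G)" "H \<in> intersection_vertices G" "K \<in> intersection_vertices G"
    and "H \<inter> K = {\<one>\<^bsub>G\<^esub>}"
  shows "hyper_dist (intersection_hypergraph G) H K \<le> 1"
proof -
  obtain E where "E \<in> hyperedges (intersection_hypergraph G)" "H \<in> E" "K \<in> E"
    using ex_hyperedge[OF assms] by blast
  \<comment> \<open>If they were equal, \<open>H\<close> would be its own intersection with
    \<open>K\<close>, hence trivial.\<close>
  moreover have "H \<noteq> K"
    using assms intersection_vertex_nontrivial by fastforce
  ultimately show ?thesis
    using hyper_dist_le[of "intersection_hypergraph G" H "[H, K]" "[E]" K] assms
    by (simp add: hyper_path_between_def hyper_path_def one_enat_def)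
qed

lemma intersection_dist_le_2:
  assumes "finite (carrier G)" "H \<in> intersection_vertices G" "K \<in> intersection_vertices G"
    and L: "L \<in> intersection_vertices G" "H \<inter> L = {\<one>\<^bsub>G\<^esub>}" "L \<inter> K = {\<one>\<^bsub>G\<^esub>}"
  shows "hyper_dist (intersection_hypergraph G) H K \<le> 2"
\<comment> \<open>In these cases the walk \<open>H\<close>, \<open>L\<close>, \<open>K\<close> may
  repeat a vertex or a hyperedge and so fail to be a path, but a shorter path exists.\<close>
proof (cases "H = K \<or> H \<inter> K = {\<one>\<^bsub>G\<^esub>}")
  case True
  then have "hyper_dist (intersection_hypergraph G) H K \<le> 1"
    using intersection_dist_refl[OF assms(2)] intersection_dist_le_1[OF assms(1-3)] by auto
  also have "(1::enat) \<le> 2"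
    by simp
  finally show ?thesis .
next
  case False
  obtain E where E: "E \<in> hyperedges (intersection_hypergraph G)" "H \<in> E" "L \<in> E"
    using ex_hyperedge[OF assms(1,2) L(1,2)] by blast
  obtain F where F: "F \<in> hyperedges (intersection_hypergraph G)" "L \<in> F" "K \<in> F"
    using ex_hyperedge[OF assms(1) L(1) assms(3) L(3)] by blast
  have "H \<noteq> L" "L \<noteq> K"
    using L assms(2,3) intersection_vertex_nontrivial by fastforce+
  \<comment> \<open>A common hyperedge would contain both \<open>H\<close> and \<open>K\<close> and
    force them to meet trivially.\<close>
  moreover have "E \<noteq> F"
    using False E F hyperedge_inter_trivial by metis
  ultimately have "hyper_path_between (intersection_hypergraph G) H [H, L, K] [E, F] K"
    using E F False assms
    by (auto simp: hyper_path_between_def hyper_path_def less_Suc_eq)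
  from hyper_dist_le[OF this] show ?thesis
    by (simp add: numeral_eq_enat numeral_2_eq_2 numeral_3_eq_3)
qed

lemma intersection_dist_le_3:
  assumes "finite (carrier G)" "H \<in> intersection_vertices G" "K \<in> intersection_vertices G"
    and LM: "L \<in> intersection_vertices G" "M \<in> intersection_vertices G"
      "H \<inter> L = {\<one>\<^bsub>G\<^esub>}" "L \<inter> M = {\<one>\<^bsub>G\<^esub>}" "M \<inter> K = {\<one>\<^bsub>G\<^esub>}"
  shows "hyper_dist (intersection_hypergraph G) H K \<le> 3"
\<comment> \<open>Each alternative is a shortcut in the chain \<open>H\<close>, \<open>L\<close>,
  \<open>M\<close>, \<open>K\<close>; excluding all of them makes the chain a genuine path.\<close>
proof (cases "H = K \<or> H \<inter> K = {\<one>\<^bsub>G\<^esub>} \<or> H \<inter> M = {\<one>\<^bsub>G\<^esub>} \<or> L \<inter> K = {\<one>\<^bsub>G\<^esub>}")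
  case True
  then have "hyper_dist (intersection_hypergraph G) H K \<le> 2"
  proof (elim disjE)
    assume "H \<inter> K = {\<one>\<^bsub>G\<^esub>}"
    then have "hyper_dist (intersection_hypergraph G) H K \<le> 1"
      using intersection_dist_le_1 assms(1-3) by blast
    also have "(1::enat) \<le> 2"
      by simp
    finally show ?thesis .
  next
    assume "H \<inter> M = {\<one>\<^bsub>G\<^esub>}"
    with intersection_dist_le_2[OF assms(1-3) LM(2)] LM(5) show ?thesis
      by blast
  next
    assume "L \<inter> K = {\<one>\<^bsub>G\<^esub>}"
    with intersection_dist_le_2[OF assms(1-3) LM(1)] LM(3) show ?thesis
      by blast
  qed (use intersection_dist_refl[OF assms(2)] in simp)
  also have "(2::enat) \<le> 3"
    by simp
  finally show ?thesis .
next
  case False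
  obtain D where D: "D \<in> hyperedges (intersection_hypergraph G)" "H \<in> D" "L \<in> D"
    using ex_hyperedge[OF assms(1,2) LM(1,3)] by blast
  obtain E where E: "E \<in> hyperedges (intersection_hypergraph G)" "L \<in> E" "M \<in> E"
    using ex_hyperedge[OF assms(1) LM(1,2,4)] by blast
  obtain F where F: "F \<in> hyperedges (intersection_hypergraph G)" "M \<in> F" "K \<in> F"
    using ex_hyperedge[OF assms(1) LM(2) assms(3) LM(5)] by blast
  \<comment> \<open>Consecutive members differ because they are nontrivial; \<open>H = M\<close> or
    \<open>L = K\<close> would make \<open>H\<close> and \<open>K\<close> meet trivially.\<close>
  have ne: "H \<noteq> L" "L \<noteq> M" "M \<noteq> K" "H \<noteq> M" "L \<noteq> K"
    using LM False assms(2,3) intersection_vertex_nontrivial by fastforce+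
  \<comment> \<open>Equalities would put \<open>H\<close> and \<open>M\<close>, \<open>L\<close> and
    \<open>K\<close>, or \<open>H\<close> and \<open>K\<close>, respectively, into one hyperedge,
    which is an excluded shortcut.\<close>
  moreover have "D \<noteq> E" "E \<noteq> F" "D \<noteq> F"
    using False D E F ne hyperedge_inter_trivial by metis+
  ultimately have
    "hyper_path_between (intersection_hypergraph G) H [H, L, M, K] [D, E, F] K"
    using D E F False assms
    by (auto simp: hyper_path_between_def hyper_path_def less_Suc_eq)
  from hyper_dist_le[OF this] show ?thesis
    by (simp add: numeral_eq_enat numeral_2_eq_2 numeral_3_eq_3)
qed

section \<open>Lower bounds for distances\<close>

lemma intersection_dist_ge_1:
  assumes "H \<noteq> K"
  shows "1 \<le> hyper_dist (intersection_hypergraph G) H K"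
  unfolding one_enat_def
proof (rule hyper_dist_ge)
  fix vs es assume "hyper_path_between (intersection_hypergraph G) H vs es K"
  with assms show "1 \<le> length es"
    by (cases es) (auto simp: hyper_path_between_def hyper_path_def length_Suc_conv)
qed

lemma intersection_dist_ge_2:
  assumes "H \<noteq> K" "H \<inter> K \<noteq> {\<one>\<^bsub>G\<^esub>}"
  shows "2 \<le> hyper_dist (intersection_hypergraph G) H K"
  unfolding numeral_eq_enat
proof (rule hyper_dist_ge)
  fix vs es assume path: "hyper_path_between (intersection_hypergraph G) H vs es K"
  have "length es \<noteq> 0"
    using path assms(1) by (auto simp: hyper_path_between_def hyper_path_def length_Suc_conv)
  moreover have "length es \<noteq> 1"
  proof
    assume "length es = 1"
    then obtain E where es: "es = [E]"
      by (auto simp: length_Suc_conv)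
    then have "vs = [H, K]"
      using path by (auto simp: hyper_path_between_def hyper_path_def length_Suc_conv)
    then have "E \<in> hyperedges (intersection_hypergraph G)" "H \<in> E" "K \<in> E"
      using path es by (auto simp: hyper_path_between_def hyper_path_def)
    with assms hyperedge_inter_trivial show False
      by metis
  qed
  ultimately show "2 \<le> length es"
    by linarith
qed

text \<open>The middle vertex of a path with two hyperedges differs from both ends and shares a
  hyperedge with each, so it meets both trivially.\<close>

lemma intersection_dist_ge_3:
  assumes "H \<noteq> K" "H \<inter> K \<noteq> {\<one>\<^bsub>G\<^esub>}"
    and no: "\<And>L. L \<in> intersection_vertices G \<Longrightarrow> H \<inter> L = {\<one>\<^bsub>G\<^esub>} \<Longrightarrow> L \<inter> K \<noteq> {\<one>\<^bsub>G\<^esub>}"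
  shows "3 \<le> hyper_dist (intersection_hypergraph G) H K"
  unfolding numeral_eq_enat
proof (rule hyper_dist_ge)
  fix vs es assume path: "hyper_path_between (intersection_hypergraph G) H vs es K"
  have "enat 2 \<le> enat (length es)"
    using intersection_dist_ge_2[OF assms(1,2)] hyper_dist_le[OF path]
    by (metis numeral_eq_enat order_trans)
  moreover have "length es \<noteq> 2"
  proof
    assume "length es = 2"
    then obtain E F where es: "es = [E, F]"
      by (auto simp: length_Suc_conv numeral_2_eq_2)
    then obtain L where "vs = [H, L, K]"
      using path by (auto simp: hyper_path_between_def hyper_path_def length_Suc_conv)
    then have "L \<in> intersection_vertices G" "H \<noteq> L" "L \<noteq> K"
      "E \<in> hyperedges (intersection_hypergraph G)" "H \<in> E" "L \<in> E"
      "F \<in> hyperedges (intersection_hypergraph G)" "L \<in> F" "K \<in> F"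
      using path es by (auto simp: hyper_path_between_def hyper_path_def less_Suc_eq)
    then show False
      using no hyperedge_inter_trivial by metis
  qed
  ultimately show "3 \<le> length es"
    by simp
qed

section \<open>Subgroups of \<open>\<int>\<^sub>n\<close>\<close>

text \<open>The \<open>d\<close>-torsion of the cyclic group, on the representatives from 0 to
  \<open>n - 1\<close>. For \<open>d\<close> dividing \<open>n\<close> it is the subgroup of order
  \<open>d\<close>; describing it by divisibility instead of by the generator \<open>n / d\<close>
  turns intersections directly into gcds.\<close>

definition zmod_torsion :: "nat \<Rightarrow> nat \<Rightarrow> int set" where
  "zmod_torsion n d = {x \<in> {0..<int n}. int n dvd int d * x}"

lemma subgroup_zmod_torsion:
  assumes "n > 0"
  shows "subgroup (zmod_torsion n d) (integer_mod_group n)"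
proof (rule group.subgroupI)
  show "zmod_torsion n d \<subseteq> carrier (integer_mod_group n)"
    using assms by (auto simp: zmod_torsion_def carrier_integer_mod_group)
  show "zmod_torsion n d \<noteq> {}"
    using assms by (auto simp: zmod_torsion_def intro!: exI[of _ 0])
next
  fix x assume "x \<in> zmod_torsion n d"
  then have x: "x \<in> carrier (integer_mod_group n)" "int n dvd int d * x"
    using assms by (auto simp: zmod_torsion_def carrier_integer_mod_group)
  have "int n dvd int d * ((- x) mod int n)"
    using x(2) by (metis dvd_minus_iff dvd_eq_mod_eq_0 mod_mult_right_eq mult_minus_right)
  then show "inv\<^bsub>integer_mod_group n\<^esub> x \<in> zmod_torsion n d"
    using x(1) assms by (simp add: zmod_torsion_def)
next
  fix x y assume "x \<in> zmod_torsion n d" "y \<in> zmod_torsion n d"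
  then have "int n dvd int d * (x + y)"
    by (simp add: zmod_torsion_def distrib_left)
  then have "int n dvd int d * ((x + y) mod int n)"
    by (metis dvd_eq_mod_eq_0 mod_mult_right_eq)
  then show "x \<otimes>\<^bsub>integer_mod_group n\<^esub> y \<in> zmod_torsion n d"
    using assms by (simp add: zmod_torsion_def)
qed simp

text \<open>With \<open>n = d * k\<close> the torsion condition reduces to \<open>k\<close> dividing
  \<open>x\<close>, and exactly \<open>d\<close> multiples of \<open>k\<close> lie in the range of
  representatives.\<close>

lemma card_zmod_torsion:
  assumes "n > 0" "d dvd n"
  shows "card (zmod_torsion n d) = d"
proof -
  obtain k where n: "n = d * k"
    using assms(2) by blast
  have dk: "d > 0" "k > 0"
    using assms n by auto
  have "zmod_torsion n d = (\<lambda>i. int k * i) ` {0..<int d}"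
  proof (intro equalityI subsetI)
    fix x assume "x \<in> zmod_torsion n d"
    then have x: "0 \<le> x" "x < int d * int k" "int k dvd x"
      using dk by (auto simp: zmod_torsion_def n)
    then obtain i where i: "x = int k * i"
      by blast
    then have "0 \<le> i" "i < int d"
      using x dk by (auto simp: zero_le_mult_iff mult.commute)
    then show "x \<in> (\<lambda>i. int k * i) ` {0..<int d}"
      using i by auto
  next
    fix x assume "x \<in> (\<lambda>i. int k * i) ` {0..<int d}"
    then show "x \<in> zmod_torsion n d"
      using dk by (auto simp: zmod_torsion_def n mult.commute)
  qed
  moreover have "inj_on (\<lambda>i. int k * i) {0..<int d}"
    using dk by (auto simp: inj_on_def)
  ultimately show ?thesis
    by (simp add: card_image)
qed

text \<open>Dividing both \<open>a * x\<close> and \<open>b * x\<close> means dividing their gcd,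
  which is \<open>gcd a b * x\<close> up to sign.\<close>

lemma zmod_torsion_Int: "zmod_torsion n a \<inter> zmod_torsion n b = zmod_torsion n (gcd a b)"
proof -
  have "int n dvd int (gcd a b) * x \<longleftrightarrow> int n dvd int a * x \<and> int n dvd int b * x" for x
  proof -
    have "int n dvd gcd (int a * x) (int b * x) \<longleftrightarrow> int n dvd int (gcd a b) * x"
      by (simp only: gcd_mult_right dvd_normalize_iff gcd_int_int_eq gcd.commute)
    then show ?thesis
      by simp
  qed
  then show ?thesis
    by (auto simp: zmod_torsion_def)
qed

lemma zmod_torsion_1:
  assumes "n > 0"
  shows "zmod_torsion n 1 = {0}"
proof (intro equalityI subsetI)
  fix x assume "x \<in> zmod_torsion n 1"
  then have x: "0 \<le> x" "x < int n" "int n dvd x"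
    by (simp_all add: zmod_torsion_def)
  then have "\<not> 0 < x"
    using zdvd_not_zless by blast
  then show "x \<in> {0}"
    using x(1) by simp
qed (use assms in \<open>simp add: zmod_torsion_def\<close>)

lemma zmod_torsion_self: "n > 0 \<Longrightarrow> zmod_torsion n n = carrier (integer_mod_group n)"
  by (auto simp: zmod_torsion_def carrier_integer_mod_group)

text \<open>The divisor is recovered as the cardinality of the subgroup.\<close>

lemma zmod_torsion_inject:
  assumes "n > 0" "a dvd n" "b dvd n"
  shows "zmod_torsion n a = zmod_torsion n b \<longleftrightarrow> a = b"
  using card_zmod_torsion[OF assms(1,2)] card_zmod_torsion[OF assms(1,3)] by metis

lemma zmod_torsion_Int_trivial_iff:
  assumes "n > 0" "a dvd n" "b dvd n"
  shows "zmod_torsion n a \<inter> zmod_torsion n b = {0} \<longleftrightarrow> coprime a b"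
proof -
  have "gcd a b dvd n"
    using assms(2) by (meson dvd_trans gcd_dvd1)
  then show ?thesis
    using assms(1) zmod_torsion_inject[of n "gcd a b" 1]
    by (simp add: zmod_torsion_Int zmod_torsion_1[symmetric] coprime_iff_gcd_eq_1 del: One_nat_def)
qed

text \<open>By Lagrange the order of \<open>H\<close> divides \<open>n\<close>, and it annihilates
  every element of \<open>H\<close>. So \<open>H\<close> lies inside the torsion subgroup of the
  same finite size and equals it.\<close>

lemma subgroup_integer_mod_group:
  assumes "n > 0" and H: "subgroup H (integer_mod_group n)"
  shows "card H dvd n" "H = zmod_torsion n (card H)"
proof -
  interpret group "integer_mod_group n"
    by simp
  have "order (integer_mod_group n) = n"
    using assms(1) by (simp add: order_def carrier_integer_mod_group)
  then show dvd: "card H dvd n"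
    using lagrange[OF H] by (metis dvd_triv_right)
  have "H \<subseteq> zmod_torsion n (card H)"
  proof
    fix x assume x: "x \<in> H"
    then have "x \<in> carrier (integer_mod_group n)"
      using subgroup.subset[OF H] by blast
    \<comment> \<open>The order theorem is applied in \<open>H\<close> as a group of its own;
      \<open>nat_pow_consistent\<close> moves the power to the ambient group.\<close>
    moreover have "x [^]\<^bsub>integer_mod_group n\<^esub> card H = \<one>\<^bsub>integer_mod_group n\<^esub>"
      using group.pow_order_eq_1[OF subgroup.subgroup_is_group[OF H group_axioms], of x] x
      by (simp add: order_def nat_pow_consistent[symmetric] del: pow_integer_mod_group)
    ultimately show "x \<in> zmod_torsion n (card H)"
      using assms(1) by (simp add: zmod_torsion_def carrier_integer_mod_group dvd_eq_mod_eq_0)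
  qed
  moreover have "finite (zmod_torsion n (card H))"
    unfolding zmod_torsion_def by (rule finite_subset[of _ "{0..<int n}"]) auto
  ultimately show "H = zmod_torsion n (card H)"
    using card_subset_eq card_zmod_torsion[OF assms(1) dvd] by metis
qed

lemma nontrivial_proper_subgroups_integer_mod_group:
  assumes "n > 0"
  shows "nontrivial_proper_subgroups (integer_mod_group n) =
    zmod_torsion n ` {d. d dvd n \<and> d \<noteq> 1 \<and> d \<noteq> n}"
proof (intro equalityI subsetI)
  fix H assume "H \<in> nontrivial_proper_subgroups (integer_mod_group n)"
  then have H: "subgroup H (integer_mod_group n)" "H \<noteq> {0}" "H \<noteq> carrier (integer_mod_group n)"
    by (auto simp: nontrivial_proper_subgroups_def)
  note * = subgroup_integer_mod_group[OF assms H(1)]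
  have "card H \<noteq> 1" "card H \<noteq> n"
    using *(2) H(2,3) zmod_torsion_1[OF assms] zmod_torsion_self[OF assms] by metis+
  then show "H \<in> zmod_torsion n ` {d. d dvd n \<and> d \<noteq> 1 \<and> d \<noteq> n}"
    using * by blast
next
  fix H assume "H \<in> zmod_torsion n ` {d. d dvd n \<and> d \<noteq> 1 \<and> d \<noteq> n}"
  then obtain d where d: "H = zmod_torsion n d" "d dvd n" "d \<noteq> 1" "d \<noteq> n"
    by blast
  then have "H \<noteq> {0}" "H \<noteq> carrier (integer_mod_group n)"
    using zmod_torsion_inject[OF assms, of d] zmod_torsion_1[OF assms]
      zmod_torsion_self[OF assms] by (metis one_dvd, metis dvd_refl)
  then show "H \<in> nontrivial_proper_subgroups (integer_mod_group n)"
    using d(1) subgroup_zmod_torsion[OF assms] by (simp add: nontrivial_proper_subgroups_def)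
qed

section \<open>Vertices as divisors missing a prime\<close>

definition prime_missing_divisors :: "nat \<Rightarrow> nat set" where
  "prime_missing_divisors n = {d. d dvd n \<and> d \<noteq> 1 \<and> (\<exists>p \<in> prime_factors n. \<not> p dvd d)}"

text \<open>A partner subgroup of order \<open>e\<close> coprime to \<open>d\<close> supplies a
  prime of \<open>e\<close> that \<open>d\<close> misses. Conversely, a missed prime
  \<open>p\<close> supplies the subgroup of order \<open>p\<close> as partner.\<close>

lemma intersection_vertices_integer_mod_group:
  assumes "n > 0"
  shows "intersection_vertices (integer_mod_group n) =
    zmod_torsion n ` prime_missing_divisors n"
proof (intro equalityI subsetI)
  fix H assume "H \<in> intersection_vertices (integer_mod_group n)"
  then obtain d e where d: "H = zmod_torsion n d" "d dvd n" "d \<noteq> 1" and e: "e dvd n" "e \<noteq> 1"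
    and "zmod_torsion n d \<inter> zmod_torsion n e = {0}"
    using nontrivial_proper_subgroups_integer_mod_group[OF assms]
    by (auto simp: intersection_vertices_def)
  then have "coprime d e"
    using zmod_torsion_Int_trivial_iff[OF assms] by blast
  obtain p where p: "prime p" "p dvd e"
    using e(2) prime_factor_nat by blast
  then have "\<not> p dvd d"
    using \<open>coprime d e\<close> by (meson coprime_common_divisor not_prime_unit)
  moreover have "p \<in> prime_factors n"
    using p e(1) assms by (auto simp: in_prime_factors_iff intro: dvd_trans)
  ultimately show "H \<in> zmod_torsion n ` prime_missing_divisors n"
    using d by (auto simp: prime_missing_divisors_def)
next
  fix H assume "H \<in> zmod_torsion n ` prime_missing_divisors n"
  then obtain d p where d: "H = zmod_torsion n d" "d dvd n" "d \<noteq> 1"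
    and "p \<in> prime_factors n" and pd: "\<not> p dvd d"
    by (auto simp: prime_missing_divisors_def)
  then have p: "prime p" "p dvd n"
    by auto
  \<comment> \<open>If \<open>p = n\<close>, then \<open>d\<close>, being a divisor of the prime
    \<open>p\<close> other than 1, would be \<open>p\<close>, contradicting that \<open>p\<close>
    does not divide \<open>d\<close>.\<close>
  then have "d \<noteq> n" "p \<noteq> n" "p \<noteq> 1"
    using pd d prime_nat_iff[of p] by auto
  moreover have "zmod_torsion n d \<inter> zmod_torsion n p = {0}"
    using zmod_torsion_Int_trivial_iff[OF assms d(2) p(2)] p(1) pd
    by (metis coprime_commute prime_imp_coprime)
  ultimately show "H \<in> intersection_vertices (integer_mod_group n)"
    using nontrivial_proper_subgroups_integer_mod_group[OF assms] d p
    by (auto simp: intersection_vertices_def)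
qed

text \<open>A second prime factor of \<open>n\<close> is missed by \<open>p\<close>. This makes
  prime factors available as the inner vertices of connecting paths.\<close>

lemma prime_factor_missing:
  assumes "omega n \<ge> 2" "p \<in> prime_factors n"
  shows "p \<in> prime_missing_divisors n"
proof -
  have "\<not> prime_factors n \<subseteq> {p}"
    using assms(1) card_mono[of "{p}" "prime_factors n"] by (auto simp: omega_def)
  then obtain q where "q \<in> prime_factors n" "q \<noteq> p"
    by blast
  have "prime p" "prime q"
    using assms(2) \<open>q \<in> prime_factors n\<close> by auto
  then have "\<not> q dvd p"
    using \<open>q \<noteq> p\<close> primes_dvd_imp_eq by blast
  then show ?thesis
    using assms(2) \<open>q \<in> prime_factors n\<close> \<open>prime p\<close>
    by (auto simp: prime_missing_divisors_def)
qed

section \<open>The intersection hypergraph of \<open>\<int>\<^sub>n\<close>\<close>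

context
  fixes n :: nat
  assumes n: "n > 0" "omega n \<ge> 2"
begin

abbreviation zmod_hypergraph :: "int set hypergraph" where
  "zmod_hypergraph \<equiv> intersection_hypergraph (integer_mod_group n)"

abbreviation divisor_dist :: "nat \<Rightarrow> nat \<Rightarrow> enat" where
  "divisor_dist a b \<equiv> hyper_dist zmod_hypergraph (zmod_torsion n a) (zmod_torsion n b)"

lemma finite_zmod: "finite (carrier (integer_mod_group n))"
  using n by (simp add: carrier_integer_mod_group)

lemma missing_dvd: "d \<in> prime_missing_divisors n \<Longrightarrow> d dvd n"
  by (simp add: prime_missing_divisors_def)

lemma missing_vertex:
  "d \<in> prime_missing_divisors n \<Longrightarrow> zmod_torsion n d \<in> intersection_vertices (integer_mod_group n)"
  using intersection_vertices_integer_mod_group[OF n(1)] by blast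

lemma missing_Int_iff:
  "a \<in> prime_missing_divisors n \<Longrightarrow> b \<in> prime_missing_divisors n \<Longrightarrow>
    zmod_torsion n a \<inter> zmod_torsion n b = {\<one>\<^bsub>integer_mod_group n\<^esub>} \<longleftrightarrow> coprime a b"
  using zmod_torsion_Int_trivial_iff[OF n(1)] missing_dvd by simp

lemma missing_inject:
  "a \<in> prime_missing_divisors n \<Longrightarrow> b \<in> prime_missing_divisors n \<Longrightarrow>
    zmod_torsion n a = zmod_torsion n b \<longleftrightarrow> a = b"
  using zmod_torsion_inject[OF n(1)] missing_dvd by simp

lemma divisor_dist_le_1:
  assumes "a \<in> prime_missing_divisors n" "b \<in> prime_missing_divisors n" "a = b \<or> coprime a b"
  shows "divisor_dist a b \<le> 1"
proof (cases "a = b")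
  case True
  then show ?thesis
    using intersection_dist_refl[OF missing_vertex[OF assms(1)]] by simp
next
  case False
  then have "coprime a b"
    using assms(3) by blast
  then show ?thesis
    using intersection_dist_le_1[OF finite_zmod assms(1,2)[THEN missing_vertex]]
      missing_Int_iff[OF assms(1,2)] by blast
qed

text \<open>The subgroup of order \<open>p\<close> is a common neighbour.\<close>

lemma divisor_dist_le_2:
  assumes "a \<in> prime_missing_divisors n" "b \<in> prime_missing_divisors n"
    and "p \<in> prime_factors n" "\<not> p dvd a" "\<not> p dvd b"
  shows "divisor_dist a b \<le> 2"
proof -
  have p: "p \<in> prime_missing_divisors n"
    using prime_factor_missing n(2) assms(3) by blast
  have "coprime a p" "coprime p b"
    using assms by (metis coprime_commute in_prime_factors_iff prime_imp_coprime)+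
  then show ?thesis
    using intersection_dist_le_2[OF finite_zmod missing_vertex missing_vertex missing_vertex]
      missing_Int_iff p assms by blast
qed

lemma divisor_dist_le_3:
  assumes "a \<in> prime_missing_divisors n" "b \<in> prime_missing_divisors n"
  shows "divisor_dist a b \<le> 3"
proof -
  obtain p q where p: "p \<in> prime_factors n" "\<not> p dvd a" and q: "q \<in> prime_factors n" "\<not> q dvd b"
    using assms by (auto simp: prime_missing_divisors_def)
  have V: "p \<in> prime_missing_divisors n" "q \<in> prime_missing_divisors n"
    using prime_factor_missing n(2) p q by blast+
  have co: "coprime a p" "coprime q b"
    using p q by (metis coprime_commute in_prime_factors_iff prime_imp_coprime)+
  show ?thesis
  \<comment> \<open>For equal primes the chain \<open>a\<close>, \<open>p\<close>, \<open>q\<close>,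
    \<open>b\<close> degenerates, but then \<open>p\<close> itself is missed by both ends.\<close>
  proof (cases "p = q")
    case True
    then have "divisor_dist a b \<le> 2"
      using divisor_dist_le_2 assms p q by blast
    also have "(2::enat) \<le> 3"
      by simp
    finally show ?thesis .
  next
    case False
    then have "coprime p q"
      using p q by (auto intro: primes_coprime)
    then show ?thesis
      using intersection_dist_le_3[OF finite_zmod missing_vertex missing_vertex missing_vertex
          missing_vertex] missing_Int_iff co V assms by blast
  qed
qed

lemma zmod_hyper_diam_eqI:
  assumes "\<And>a b. a \<in> prime_missing_divisors n \<Longrightarrow> b \<in> prime_missing_divisors n \<Longrightarrow>
      divisor_dist a b \<le> d"
    and "a \<in> prime_missing_divisors n" "b \<in> prime_missing_divisors n" "d \<le> divisor_dist a b"
  shows "hyper_diam zmod_hypergraph = d"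
proof (rule hyper_diam_eqI[OF _ _ _ assms(4)])
  fix u v assume "u \<in> vertices zmod_hypergraph" "v \<in> vertices zmod_hypergraph"
  then obtain a b where "u = zmod_torsion n a" "v = zmod_torsion n b"
    "a \<in> prime_missing_divisors n" "b \<in> prime_missing_divisors n"
    unfolding vertices_intersection_hypergraph intersection_vertices_integer_mod_group[OF n(1)]
    by blast
  then show "hyper_dist zmod_hypergraph u v \<le> d"
    using assms(1) by blast
qed (use assms(2,3) missing_vertex in simp_all)

lemma zmod_vertex_dist_le_3:
  assumes "u \<in> vertices zmod_hypergraph" "v \<in> vertices zmod_hypergraph"
  shows "hyper_dist zmod_hypergraph u v \<le> 3"
proof -
  obtain a b where "u = zmod_torsion n a" "v = zmod_torsion n b"
    "a \<in> prime_missing_divisors n" "b \<in> prime_missing_divisors n"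
    using assms
    unfolding vertices_intersection_hypergraph intersection_vertices_integer_mod_group[OF n(1)]
    by blast
  then show ?thesis
    using divisor_dist_le_3 by blast
qed

lemma hyper_connected_zmod: "hyper_connected zmod_hypergraph"
proof (rule hyper_connectedI)
  fix u v assume "u \<in> vertices zmod_hypergraph" "v \<in> vertices zmod_hypergraph"
  then have "hyper_dist zmod_hypergraph u v \<le> 3"
    by (rule zmod_vertex_dist_le_3)
  then show "hyper_dist zmod_hypergraph u v \<noteq> \<infinity>"
    using enat_ile by (fastforce simp: numeral_eq_enat)
qed

lemma zmod_diam_le_3: "hyper_diam zmod_hypergraph \<le> 3"
  using zmod_vertex_dist_le_3 by (rule hyper_diam_leI)

section \<open>The exact diameter in the three cases\<close>

lemma zmod_diam_pq:
  assumes "p \<noteq> q" "prime_factors n = {p, q}" "n = p * q"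
  shows "hyper_diam zmod_hypergraph = 1"
proof (rule zmod_hyper_diam_eqI)
  have pr: "prime p" "prime q"
    using assms(2) by auto
  have V: "d = p \<or> d = q" if "d \<in> prime_missing_divisors n" for d
  proof -
    have "d dvd p * q" "d \<noteq> 1" "\<not> p dvd d \<or> \<not> q dvd d"
      using that assms by (auto simp: prime_missing_divisors_def)
    \<comment> \<open>A divisor missing one of the two primes is coprime to it and so divides the
      other.\<close>
    then have "d dvd p \<or> d dvd q"
      using pr by (metis coprime_dvd_mult_left_iff coprime_dvd_mult_right_iff coprime_commute
          prime_imp_coprime)
    then show ?thesis
      using pr \<open>d \<noteq> 1\<close> by (auto simp: prime_nat_iff)
  qed
  show "divisor_dist a b \<le> 1"
    if "a \<in> prime_missing_divisors n" "b \<in> prime_missing_divisors n" for a b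
    using that V[of a] V[of b] pr divisor_dist_le_1 primes_coprime by metis
  show *: "p \<in> prime_missing_divisors n" "q \<in> prime_missing_divisors n"
    using prime_factor_missing n(2) assms(2) by auto
  show "1 \<le> divisor_dist p q"
    using intersection_dist_ge_1 missing_inject * assms(1) by metis
qed

text \<open>If \<open>n\<close> is not the product of its two primes, the square of one of them,
  \<open>r\<close>, divides \<open>n\<close>. The vertices \<open>r\<close> and \<open>r * r\<close>
  are distinct but not coprime, so their distance is at least 2.\<close>

lemma zmod_diam_two_primes:
  assumes "p \<noteq> q" "prime_factors n = {p, q}" "n \<noteq> p * q"
  shows "hyper_diam zmod_hypergraph = 2"
proof -
  have pr: "prime p" "prime q" "p dvd n" "q dvd n"
    using assms(2) by auto
  then have co: "coprime p q"
    using primes_coprime assms(1) by blast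
  have "p * q dvd n"
    using pr co by (simp add: divides_mult)
  then obtain k where k: "n = p * q * k"
    by blast
  with assms(3) have "k \<noteq> 1"
    by auto
  then obtain r where "prime r" "r dvd k"
    using prime_factor_nat by blast
  then have "r \<in> prime_factors n"
    using k n(1) by (auto simp: in_prime_factors_iff)
  then have "r = p \<or> r = q"
    using assms(2) by blast
  \<comment> \<open>\<open>s\<close> is the other of the two primes. One factor \<open>r\<close>
    comes from \<open>p * q\<close> and one from \<open>k\<close>.\<close>
  then obtain s where s: "prime s" "s \<noteq> r" "s \<in> prime_factors n" "r * r dvd n"
    using \<open>r dvd k\<close> k pr assms(1,2)
    by (metis dvd_mult2 insertCI mult.assoc mult.commute mult_dvd_mono dvd_refl)
  have "\<not> s dvd r * r"
    using s \<open>prime r\<close> by (metis prime_dvd_mult_iff primes_dvd_imp_eq)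
  then have V: "r * r \<in> prime_missing_divisors n"
    using s \<open>prime r\<close> by (auto simp: prime_missing_divisors_def)
  have Vr: "r \<in> prime_missing_divisors n"
    using prime_factor_missing n(2) \<open>r \<in> prime_factors n\<close> by blast
  have "2 \<le> divisor_dist r (r * r)"
  proof (rule intersection_dist_ge_2)
    show "zmod_torsion n r \<noteq> zmod_torsion n (r * r)"
      using missing_inject[OF Vr V] prime_gt_1_nat[OF \<open>prime r\<close>] by simp
    show "zmod_torsion n r \<inter> zmod_torsion n (r * r) \<noteq> {\<one>\<^bsub>integer_mod_group n\<^esub>}"
      using missing_Int_iff[OF Vr V] prime_gt_1_nat[OF \<open>prime r\<close>] by simp
  qed
  moreover have "divisor_dist a b \<le> 2"
    if ab: "a \<in> prime_missing_divisors n" "b \<in> prime_missing_divisors n" for a b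
  proof (cases "\<exists>t \<in> prime_factors n. \<not> t dvd a \<and> \<not> t dvd b")
    case True
    then show ?thesis
      using divisor_dist_le_2 ab by blast
  next
    case False
    \<comment> \<open>Each of \<open>a\<close> and \<open>b\<close> misses a prime but they miss
      none in common, so between them both primes are missed and no prime is shared.\<close>
    then have *: "(\<not> p dvd a \<and> \<not> q dvd b) \<or> (\<not> q dvd a \<and> \<not> p dvd b)"
      using ab assms(2) by (auto simp: prime_missing_divisors_def)
    have "coprime a b"
    proof (rule ccontr)
      assume "\<not> coprime a b"
      then obtain t where t: "prime t" "t dvd a" "t dvd b"
        using prime_factor_nat[of "gcd a b"] by (auto simp: coprime_iff_gcd_eq_1)
      then have "t \<in> prime_factors n"
        using missing_dvd[OF ab(1)] n(1) by (auto simp: in_prime_factors_iff intro: dvd_trans)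
      then show False
        using * t assms(2) by auto
    qed
    then have "divisor_dist a b \<le> 1"
      using divisor_dist_le_1 ab by blast
    also have "(1::enat) \<le> 2"
      by simp
    finally show ?thesis .
  qed
  ultimately show ?thesis
    using zmod_hyper_diam_eqI V Vr by blast
qed

lemma zmod_diam_three_primes:
  assumes "omega n \<ge> 3"
  shows "hyper_diam zmod_hypergraph = 3"
proof -
  obtain P where "P \<subseteq> prime_factors n" "card P = 3"
    using assms obtain_subset_with_card_n unfolding omega_def by metis
  then obtain p q r where pqr: "{p, q, r} \<subseteq> prime_factors n" "p \<noteq> q" "p \<noteq> r" "q \<noteq> r"
    by (auto simp: card_3_iff)
  \<comment> \<open>The squarefree divisor of \<open>n\<close> that misses exactly the prime factor
    \<open>t\<close>; the extremal pair is \<open>f p\<close> and \<open>f q\<close>.\<close>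
  define f where "f t = \<Prod>(prime_factors n - {t})" for t
  have f_dvd: "s dvd f t \<longleftrightarrow> s \<noteq> t" if s: "s \<in> prime_factors n" for s t
  proof
    assume "s dvd f t"
    then obtain u where "u \<in> prime_factors n - {t}" "s dvd u"
      using s prime_dvd_prod_iff[of "prime_factors n - {t}" s "\<lambda>x. x"]
      by (auto simp: f_def)
    moreover from this have "s = u"
      using s by (meson DiffD1 in_prime_factors_imp_prime primes_dvd_imp_eq)
    ultimately show "s \<noteq> t"
      by simp
  next
    assume "s \<noteq> t"
    with s show "s dvd f t"
      unfolding f_def by (intro dvd_prodI) auto
  qed
  have f_V: "f t \<in> prime_missing_divisors n" if "t \<in> {p, q}" for t
  proof -
    \<comment> \<open>\<open>f t\<close> divides the radical of \<open>n\<close>, which divides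
      \<open>n\<close> because taking each prime once gives a submultiset of the prime
      factorization.\<close>
    have "f t dvd \<Prod>(prime_factors n)"
      unfolding f_def by (rule prod_dvd_prod_subset) auto
    also have "\<dots> = prod_mset (mset_set (prime_factors n))"
      by (simp add: prod_unfold_prod_mset)
    also have "\<dots> dvd prod_mset (prime_factorization n)"
      by (intro prod_mset_subset_imp_dvd mset_set_set_mset_msubset)
    also have "\<dots> = n"
      using n(1) by (simp add: prod_mset_prime_factorization_nat)
    finally have "f t dvd n" .
    moreover have "f t \<noteq> 1"
    proof -
      have "r dvd f t" "prime r"
        using f_dvd[of r t] pqr that by auto
      then show ?thesis
        using not_prime_unit by auto
    qed
    ultimately show ?thesis
      using f_dvd[of t t] pqr that by (auto simp: prime_missing_divisors_def)
  qed
  have Vp: "f p \<in> prime_missing_divisors n" and Vq: "f q \<in> prime_missing_divisors n"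
    using f_V by auto
  have "3 \<le> divisor_dist (f p) (f q)"
  proof (rule intersection_dist_ge_3)
    have "p dvd f q" "\<not> p dvd f p"
      using f_dvd[of p] pqr by simp_all
    then have "f p \<noteq> f q"
      by metis
    then show "zmod_torsion n (f p) \<noteq> zmod_torsion n (f q)"
      using missing_inject Vp Vq by blast
    have "r dvd f p" "r dvd f q"
      using f_dvd[of r] pqr by simp_all
    moreover have "prime r"
      using pqr(1) by auto
    ultimately show "zmod_torsion n (f p) \<inter> zmod_torsion n (f q) \<noteq> {\<one>\<^bsub>integer_mod_group n\<^esub>}"
      using missing_Int_iff[OF Vp Vq] by (meson coprime_common_divisor not_prime_unit)
  next
    fix L assume L: "L \<in> intersection_vertices (integer_mod_group n)"
      "zmod_torsion n (f p) \<inter> L = {\<one>\<^bsub>integer_mod_group n\<^esub>}"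
    then obtain d where d: "L = zmod_torsion n d" "d \<in> prime_missing_divisors n"
      using intersection_vertices_integer_mod_group[OF n(1)] by blast
    \<comment> \<open>Every prime factor of \<open>n\<close> other than \<open>p\<close> divides
      \<open>f p\<close>, so coprimality of \<open>d\<close> to \<open>f p\<close> forces
      \<open>s = p\<close>. Since \<open>p\<close> differs from \<open>q\<close>, it divides
      \<open>f q\<close>, and \<open>d\<close> cannot be coprime to \<open>f q\<close>.\<close>
    obtain s where s: "prime s" "s dvd d"
      using d(2) prime_factor_nat by (auto simp: prime_missing_divisors_def)
    then have "s \<in> prime_factors n"
      using missing_dvd[OF d(2)] n(1) by (auto simp: in_prime_factors_iff intro: dvd_trans)
    moreover have "coprime (f p) d"
      using L d missing_Int_iff[OF Vp] by blast
    ultimately have "s dvd f q"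
      using f_dvd s pqr(2) by (metis coprime_common_divisor not_prime_unit)
    then have "\<not> coprime d (f q)"
      using s by (meson coprime_common_divisor not_prime_unit)
    then show "L \<inter> zmod_torsion n (f q) \<noteq> {\<one>\<^bsub>integer_mod_group n\<^esub>}"
      using d missing_Int_iff[OF _ Vq] by blast
  qed
  then show ?thesis
    using zmod_hyper_diam_eqI divisor_dist_le_3 Vp Vq by blast
qed

end

theorem theorem3p5:
  fixes n :: nat
  assumes "n > 0" and "omega n \<ge> 2"
  defines "\<Gamma> \<equiv> intersection_hypergraph (integer_mod_group n)"
  shows "hyper_connected \<Gamma> \<and> hyper_diam \<Gamma> \<le> 3 \<and>
    (\<forall>p1 p2. omega n = 2 \<and> p1 \<noteq> p2 \<and> prime_factors n = {p1, p2} \<longrightarrow>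
       (n = p1 * p2 \<longrightarrow> hyper_diam \<Gamma> = 1) \<and>
       (n \<noteq> p1 * p2 \<longrightarrow> hyper_diam \<Gamma> = 2)) \<and>
    (omega n \<ge> 3 \<longrightarrow> hyper_diam \<Gamma> = 3)"
  unfolding \<Gamma>_def
  using hyper_connected_zmod[OF assms(1,2)] zmod_diam_le_3[OF assms(1,2)]
    zmod_diam_pq[OF assms(1,2)] zmod_diam_two_primes[OF assms(1,2)]
    zmod_diam_three_primes[OF assms(1,2)] by blast

end
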